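(* Let $\Lambda \subset \mathbb{R}^n$ be a compact set, let $V : \Lambda \to \mathbb{R}$ be a function, and let $\{J_d\}_{d \in \mathbb{N}}$ be a family of functions $J_d : \Lambda \to \mathbb{R}$ satisfying the following properties: 1. For every $d \in \mathbb{N}$ we have $V(x) \le J_d(x)$ for all $x \in \Lambda$. 2. $\lim_{d \to \infty} \sup_{x \in \Lambda} |V(x) - J_d(x)| = 0$. Then for all $\gamma \in \mathbb{R}$, $$\lim_{d \to \infty} D_H\big(\{x \in \Lambda : J_d(x) < \gamma\}, \{x \in \Lambda : V(x) < \gamma\}\big) = 0.$$
   Context: For sets $A, B \subset \mathbb{R}^n$, the Hausdorff metric is $D_H(A,B) := \max\{H(A,B), H(B,A)\}$, where $H(A,B) := \sup_{x \in A} D(x,B)$ and $D(x,B) := \inf_{y \in B} \|x-y\|_2$. Convention: infima and suprema are taken in $[0,\infty]$, so $\inf \emptyset = +\infty$ and $\sup \emptyset = 0$. *)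

theory Defs
  imports "HOL-Analysis.Analysis"
begin

(* Distances take values in ennreal rather than real (as infdist does), so that
   the infimum over the empty set is infinity and the supremum over it is 0.
   The norm of the type real ^ 'n is the Euclidean one. *)

definition point_dist :: "real ^ 'n \<Rightarrow> (real ^ 'n) set \<Rightarrow> ennreal" where
  "point_dist x B = (INF y\<in>B. ennreal (norm (x - y)))"

definition hausdorff_excess :: "(real ^ 'n) set \<Rightarrow> (real ^ 'n) set \<Rightarrow> ennreal" where
  "hausdorff_excess A B = (SUP x\<in>A. point_dist x B)"

definition hausdorff_dist :: "(real ^ 'n) set \<Rightarrow> (real ^ 'n) set \<Rightarrow> ennreal" where
  "hausdorff_dist A B = max (hausdorff_excess A B) (hausdorff_excess B A)"

end

theory Submission
  imports Defs
begin

text \<open>Since \<open>V \<le> J d\<close>, the sublevel set of \<open>J d\<close> is contained in that of \<open>V\<close>, so only the excess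
  of the latter over the former matters. The sublevel set of \<open>V\<close> is totally bounded, hence has
  a finite \<open>e\<close>-net contained in itself. On each of the finitely many net points \<open>V\<close> is strictly
  below the level, hence so is \<open>J d\<close> for large \<open>d\<close>, and the net then lies in the sublevel set of
  \<open>J d\<close>.\<close>

lemma point_dist_le: "y \<in> B \<Longrightarrow> point_dist x B \<le> ennreal (norm (x - y))"
  unfolding point_dist_def by (rule INF_lower)

lemma hausdorff_excess_subset:
  assumes "A \<subseteq> B"
  shows "hausdorff_excess A B = 0"
proof -
  have "point_dist x B \<le> 0" if "x \<in> A" for x
    using point_dist_le[of x B x] that assms by auto
  then have "hausdorff_excess A B \<le> 0"
    unfolding hausdorff_excess_def by (rule SUP_least)
  then show ?thesis by simp
qed

text \<open>Every point of \<open>closure B\<close> is within \<open>e\<close> of a point of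
  \<open>B\<close>, so the balls centred in \<open>B\<close> itself already cover this compact set,
  and a finite subcover gives the net.\<close>

lemma bounded_finite_net:
  fixes B :: "'a::heine_borel set"
  assumes "bounded B" "0 < e"
  obtains F where "F \<subseteq> B" "finite F" "B \<subseteq> (\<Union>y\<in>F. ball y e)"
proof -
  have "closure B \<subseteq> (\<Union>y\<in>B. ball y e)"
    using \<open>0 < e\<close> by (auto simp: closure_approachable)
  moreover have "compact (closure B)"
    using \<open>bounded B\<close> by simp
  ultimately obtain F where "F \<subseteq> B" "finite F" "closure B \<subseteq> (\<Union>y\<in>F. ball y e)"
    using compactE_image[of "closure B" B "\<lambda>y. ball y e"] open_ball by blast
  with that[of F] closure_subset[of B] show thesis by (meson order_trans)
qed

text \<open>The supremum dominates the error at \<open>y\<close>, and eventually drops below the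
  positive gap \<open>c - V y\<close>.\<close>

lemma tendsto_SUP_abs_diff_imp_eventually_less:
  fixes V :: "'a \<Rightarrow> real" and J :: "'b \<Rightarrow> 'a \<Rightarrow> real"
  assumes "((\<lambda>d. SUP x\<in>S. ennreal \<bar>V x - J d x\<bar>) \<longlongrightarrow> 0) G" "y \<in> S" "V y < c"
  shows "\<forall>\<^sub>F d in G. J d y < c"
proof -
  have "\<forall>\<^sub>F d in G. (SUP x\<in>S. ennreal \<bar>V x - J d x\<bar>) < ennreal (c - V y)"
    using assms by (intro order_tendstoD) auto
  then show ?thesis
  proof eventually_elim
    case (elim d)
    then have "ennreal \<bar>V y - J d y\<bar> < ennreal (c - V y)"
      using SUP_upper[OF \<open>y \<in> S\<close>, of "\<lambda>x. ennreal \<bar>V x - J d x\<bar>"] by (rule le_less_trans[rotated])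
    then show ?case by (simp add: ennreal_less_iff)
  qed
qed

text \<open>Membership is assumed only pointwise in \<open>y\<close>; boundedness of
  \<open>B\<close> makes it uniform up to an error \<open>e\<close>, by way of a finite net.\<close>

lemma hausdorff_excess_bounded_tendsto_0:
  assumes "bounded B" and ev: "\<And>y. y \<in> B \<Longrightarrow> \<forall>\<^sub>F d in G. y \<in> A d"
  shows "((\<lambda>d. hausdorff_excess B (A d)) \<longlongrightarrow> 0) G"
proof (rule order_tendstoI)
  fix a :: ennreal assume "0 < a"
  \<comment> \<open>A supremum of distances below \<open>b\<close> is only \<open>\<le> b\<close>,
    so room is left under \<open>a\<close>. Being less than \<open>a\<close>, \<open>b\<close> is
    also finite, hence a real radius.\<close>
  then obtain b where b: "0 < b" "b < a" using dense by blast
  then obtain e where e: "b = ennreal e" "0 < e"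
    by (cases b) auto
  obtain F where F: "F \<subseteq> B" "finite F" "B \<subseteq> (\<Union>y\<in>F. ball y e)"
    using bounded_finite_net[OF \<open>bounded B\<close> \<open>0 < e\<close>] .
  \<comment> \<open>Finiteness of \<open>F\<close> lets the quantifier over its points move inside
    "eventually".\<close>
  have "\<forall>\<^sub>F d in G. \<forall>y\<in>F. y \<in> A d"
    using F ev by (intro eventually_ball_finite) auto
  then show "\<forall>\<^sub>F d in G. hausdorff_excess B (A d) < a"
  proof eventually_elim
    case (elim d)
    have "point_dist x (A d) \<le> b" if x: "x \<in> B" for x
    proof -
      obtain y where "y \<in> F" "dist y x < e"
        using F(3) x by auto
      then have "ennreal (norm (x - y)) \<le> b"
        by (simp add: e dist_norm norm_minus_commute ennreal_leI)
      then show ?thesis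
        using point_dist_le[of y "A d" x] elim \<open>y \<in> F\<close> by (meson order_trans)
    qed
    then have "hausdorff_excess B (A d) \<le> b"
      unfolding hausdorff_excess_def by (rule SUP_least)
    with b show ?case by simp
  qed
qed simp

theorem theorem1:
  fixes \<Lambda> :: "(real ^ 'n) set"
    and V :: "real ^ 'n \<Rightarrow> real"
    and J :: "nat \<Rightarrow> real ^ 'n \<Rightarrow> real"
  assumes "compact \<Lambda>"
    and "\<And>d x. x \<in> \<Lambda> \<Longrightarrow> V x \<le> J d x"
    and "(\<lambda>d. SUP x\<in>\<Lambda>. ennreal \<bar>V x - J d x\<bar>) \<longlonglongrightarrow> 0"
  shows "\<forall>\<gamma>::real. (\<lambda>d. hausdorff_dist {x \<in> \<Lambda>. J d x < \<gamma>} {x \<in> \<Lambda>. V x < \<gamma>}) \<longlonglongrightarrow> 0"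
proof
  fix \<gamma> :: real
  let ?A = "\<lambda>d. {x \<in> \<Lambda>. J d x < \<gamma>}" and ?B = "{x \<in> \<Lambda>. V x < \<gamma>}"
  have "?A d \<subseteq> ?B" for d
    using assms(2) by (auto intro: le_less_trans)
  \<comment> \<open>The inclusion makes the other excess vanish, even when \<open>?A d\<close> is
    empty.\<close>
  then have "hausdorff_dist (?A d) ?B = hausdorff_excess ?B (?A d)" for d
    by (simp add: hausdorff_dist_def hausdorff_excess_subset)
  moreover have "(\<lambda>d. hausdorff_excess ?B (?A d)) \<longlonglongrightarrow> 0"
  proof (rule hausdorff_excess_bounded_tendsto_0)
    show "bounded ?B"
      using compact_imp_bounded[OF assms(1)] by (rule bounded_subset) auto
    show "\<forall>\<^sub>F d in sequentially. y \<in> ?A d" if "y \<in> ?B" for y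
      using tendsto_SUP_abs_diff_imp_eventually_less[OF assms(3)] that by auto
  qed
  ultimately show "(\<lambda>d. hausdorff_dist (?A d) ?B) \<longlonglongrightarrow> 0" by simp
qed

end
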